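(* Every PC domain is an AP domain. That is, if $R$ is an integral domain in which every proper two-generated ideal is contained in a proper principal ideal, then every atom of $R$ is a prime element.
   Context: All rings are integral domains (commutative with identity). A non-zero non-unit element $x$ of an integral domain $R$ is an atom (irreducible) if $x=yz$ with $y,z\in R$ implies that $y$ or $z$ is a unit; it is prime if $x\mid yz$ with $y,z\in R$ implies $x\mid y$ or $x\mid z$. An ideal is two-generated if it equals $(a,b)$ for some $a,b\in R$. A PC domain is an integral domain in which every proper two-generated ideal is contained in a proper principal ideal. An AP domain is an integral domain in which every atom is prime. *)

theory Defs
  imports "HOL-Algebra.Ring_Divisibility"
begin

definition two_generated_ideal :: "'a set \<Rightarrow> ('a, 'b) ring_scheme \<Rightarrow> bool"
  where "two_generated_ideal I R \<longleftrightarrow>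
    (\<exists>a\<in>carrier R. \<exists>b\<in>carrier R. I = Idl\<^bsub>R\<^esub> {a, b})"

locale PC_domain = domain +
  assumes proper_two_generated_le_principal:
    "\<lbrakk>two_generated_ideal I R; I \<noteq> carrier R\<rbrakk> \<Longrightarrow>
      \<exists>J. principalideal J R \<and> J \<noteq> carrier R \<and> I \<subseteq> J"

locale AP_domain = domain +
  assumes atom_is_prime:
    "\<lbrakk>x \<in> carrier R; ring_irreducible x\<rbrakk> \<Longrightarrow> ring_prime x"

text \<open>
  HOL-Algebra defines irreducibility through proper factors. In a domain this is the usual
  notion of an atom.
\<close>

lemma (in domain) ring_irreducible_iff_atom:
  assumes "x \<in> carrier R"
  shows "ring_irreducible x \<longleftrightarrow>
    x \<noteq> \<zero> \<and> x \<notin> Units R \<and>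
    (\<forall>y\<in>carrier R. \<forall>z\<in>carrier R. x = y \<otimes> z \<longrightarrow> y \<in> Units R \<or> z \<in> Units R)"
  using ring_irreducibleE[OF assms] ring_irreducibleI[of x] assms by blast

end

theory Submission
  imports Defs
begin

text \<open>
  Let \<open>x\<close> be an atom dividing \<open>y z\<close>. If the ideal \<open>(x, y)\<close> is proper, it lies in some proper
  \<open>(d)\<close>; as \<open>d\<close> is a nonunit dividing the atom \<open>x\<close>, it is associated to \<open>x\<close>, so \<open>x\<close> divides \<open>y\<close>.
  Otherwise \<open>r x + s y = 1\<close> for some \<open>r\<close>, \<open>s\<close>, and \<open>x\<close> divides \<open>z = r x z + s y z\<close>.
\<close>

text \<open>The ideal generated by the union of two ideals is their sum, and elements of
  \<open>PIdl a\<close> and \<open>PIdl b\<close> are multiples of \<open>a\<close> and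
  \<open>b\<close>.\<close>

lemma (in cring) genideal_pair_memE:
  assumes "a \<in> carrier R" "b \<in> carrier R" and "c \<in> Idl {a, b}"
  obtains r s where "r \<in> carrier R" "s \<in> carrier R" "c = r \<otimes> a \<oplus> s \<otimes> b"
proof -
  \<comment> \<open>Principal ideals replace the bare generators because
    \<open>union_genideal\<close> speaks of the union of two ideals.\<close>
  have "Idl {a, b} = Idl (PIdl a \<union> PIdl b)"
  proof (rule subset_antisym)
    have carr: "PIdl a \<subseteq> carrier R" "PIdl b \<subseteq> carrier R"
      using assms(1,2) unfolding cgenideal_def by auto
    then show "Idl {a, b} \<subseteq> Idl (PIdl a \<union> PIdl b)"
      using assms(1,2) cgenideal_self by (intro subset_Idl_subset) auto
    have "{a, b} \<subseteq> Idl {a, b}" and "ideal (Idl {a, b}) R"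
      using assms(1,2) genideal_self[of "{a, b}"] genideal_ideal[of "{a, b}"] by simp_all
    then show "Idl (PIdl a \<union> PIdl b) \<subseteq> Idl {a, b}"
      using cgenideal_minimal by (intro genideal_minimal) auto
  qed
  then have "c \<in> PIdl a <+> PIdl b"
    using assms cgenideal_ideal union_genideal by simp
  then show thesis
    using that unfolding set_add_def' cgenideal_def by blast
qed

lemma (in cring) genideal_pair_eq_carrier_imp_divides:
  assumes carr: "x \<in> carrier R" "y \<in> carrier R" "z \<in> carrier R"
    and comax: "Idl {x, y} = carrier R" and dvd: "x divides y \<otimes> z"
  shows "x divides z"
proof -
  obtain r s where rs: "r \<in> carrier R" "s \<in> carrier R" "\<one> = r \<otimes> x \<oplus> s \<otimes> y"
    using genideal_pair_memE[OF carr(1,2), of \<one>] comax by auto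
  obtain t where t: "t \<in> carrier R" "y \<otimes> z = x \<otimes> t"
    using dvd unfolding factor_def by blast
  have "z = (r \<otimes> x \<oplus> s \<otimes> y) \<otimes> z"
    using carr rs(3) by (metis l_one)
  \<comment> \<open>Regrouping keeps the product \<open>y \<otimes> z\<close> intact, so that it can
    be replaced by \<open>x \<otimes> t\<close>.\<close>
  also have "\<dots> = x \<otimes> (r \<otimes> z) \<oplus> s \<otimes> (y \<otimes> z)"
    using carr rs(1,2) by algebra
  also have "\<dots> = x \<otimes> (r \<otimes> z \<oplus> s \<otimes> t)"
    unfolding t(2) using carr rs(1,2) t(1) by algebra
  finally show ?thesis
    using carr rs(1,2) t(1) unfolding factor_def by blast
qed

lemma (in domain) irreducible_divides_of_proper_principal:
  assumes carr: "x \<in> carrier R" "y \<in> carrier R" and irr: "ring_irreducible x"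
    and J: "principalideal J R" "J \<noteq> carrier R" "x \<in> J" "y \<in> J"
  shows "x divides y"
proof -
  obtain d where d: "d \<in> carrier R" "J = PIdl d"
    using principalideal.generate[OF J(1)] cgenideal_eq_genideal by auto
  have nonunit: "d \<notin> Units R"
    using ideal_eq_carrier_iff[OF d(1)] d(2) J(2) by auto
  obtain u where u: "u \<in> carrier R" "x = d \<otimes> u"
    using J(3) d m_comm unfolding cgenideal_def by auto
  obtain v where v: "v \<in> carrier R" "y = d \<otimes> v"
    using J(4) d m_comm unfolding cgenideal_def by auto
  \<comment> \<open>In the factorization of the atom as \<open>d \<otimes> u\<close> the factor
    \<open>d\<close> is a nonunit, so the cofactor is invertible and \<open>d\<close> can be written
    as a multiple of \<open>x\<close>.\<close>
  have unit: "u \<in> Units R"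
    using ring_irreducibleE(5)[OF carr(1) irr d(1) u] nonunit by blast
  then have "d = x \<otimes> inv u"
    using d(1) u by (simp add: m_assoc)
  then have "y = x \<otimes> (inv u \<otimes> v)"
    using carr(1) unit v by (simp add: m_assoc)
  then show ?thesis
    using unit v(1) unfolding factor_def by blast
qed

theorem proposition3p1:
  fixes R :: "('a, 'b) ring_scheme" (structure)
  assumes "PC_domain R"
  shows "AP_domain R"
proof -
  interpret PC_domain R by fact
  show ?thesis
  proof
    fix x assume x: "x \<in> carrier R" "ring_irreducible x"
    \<comment> \<open>In a domain \<open>prime R\<close> also holds of zero;
      \<open>ring_prime\<close> excludes it, so \<open>x \<noteq> \<zero>\<close> is supplied
      separately at the end.\<close>
    have "prime R x"
    proof (rule primeI)
      show "x \<notin> Units R"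
        using ring_irreducibleE(4)[OF x] .
    next
      fix y z assume yz: "y \<in> carrier R" "z \<in> carrier R" "x divides y \<otimes> z"
      show "x divides y \<or> x divides z"
      proof (cases "Idl {x, y} = carrier R")
        case True
        then show ?thesis
          using genideal_pair_eq_carrier_imp_divides x(1) yz by blast
      next
        case False
        moreover have "two_generated_ideal (Idl {x, y}) R"
          using x(1) yz(1) unfolding two_generated_ideal_def by blast
        ultimately obtain J where
          "principalideal J R" "J \<noteq> carrier R" "Idl {x, y} \<subseteq> J"
          using proper_two_generated_le_principal by blast
        moreover have "{x, y} \<subseteq> Idl {x, y}"
          using x(1) yz(1) by (intro genideal_self) auto
        ultimately show ?thesis
          using irreducible_divides_of_proper_principal[OF x(1) yz(1) x(2)] by blast
      qed
    qed
    then show "ring_prime x"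
      using ring_irreducibleE(1)[OF x] by (intro ring_primeI)
  qed
qed

end
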